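(* Let $f$ be a step-isometry of $\ell_\infty^d$. Then there exist a permutation $\sigma$ of $[d]=\{1,\dots,d\}$, a vector $\varepsilon=(\varepsilon_1,\varepsilon_2,\dots,\varepsilon_d)\in\{-1,+1\}^d$, and, for each $i$, an increasing bijection $g_i\colon[0,1)\to[0,1)$, such that for all $\lambda_1,\dots,\lambda_d\in\mathbb{R}$ \[ f\left(\sum_{i=1}^d\lambda_i e_i\right)-f(0)=\sum_{i=1}^d\left(g_i\left(\lambda_i-\lfloor\lambda_i\rfloor\right)+\lfloor\lambda_i\rfloor\right)\varepsilon_i e_{\sigma(i)}, \] where $e_1,e_2,\dots,e_d$ is the standard basis of $\ell_\infty^d$.
   Context: $\ell_\infty^d$ is $\mathbb{R}^d$ with norm $\|(x_1,\dots,x_d)\|=\max_i|x_i|$. A step-isometry of a normed space $V$ is a bijective function $f\colon V\to V$ such that $\lfloor\|x-y\|\rfloor=\lfloor\|f(x)-f(y)\|\rfloor$ for all $x,y\in V$. *)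

theory Defs
  imports "HOL-Analysis.Analysis"
begin

text \<open>
  The type \<^typ>\<open>real ^ 'n\<close> carries the Euclidean norm as its type-class norm, so the norm of the
  normed space is an explicit parameter \<open>N\<close>. For $\ell_\infty^d$ it is the library's
  \<^const>\<open>infnorm\<close>; the lemma below confirms that this is the maximum norm.
\<close>

definition step_isometry :: "('a::real_vector \<Rightarrow> real) \<Rightarrow> ('a \<Rightarrow> 'a) \<Rightarrow> bool" where
  "step_isometry N f \<longleftrightarrow> bij f \<and> (\<forall>x y. \<lfloor>N (x - y)\<rfloor> = \<lfloor>N (f x - f y)\<rfloor>)"

lemma infnorm_vec_eq_Max:
  fixes x :: "real ^ 'n"
  shows "infnorm x = Max (range (\<lambda>i. \<bar>x $ i\<bar>))"
proof -
  have "{\<bar>x $ i\<bar> |i. i \<in> UNIV} = range (\<lambda>i. \<bar>x $ i\<bar>)" by auto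
  then show ?thesis
    by (simp add: infnorm_cart cSup_eq_Max)
qed

end

theory Submission
  imports Defs
begin

text \<open>
  A step-isometry maps open balls of integer radius to open balls of integer radius, because
  \<open>infnorm (x - c) < n\<close> depends only on the floor of the norm. Balls of the maximum norm are
  cubes, and the cubes of integer radius that contain two points \<open>x\<close> and \<open>y\<close> intersect exactly in
  the box spanned by \<open>x\<close> and \<open>y\<close> (\<open>box_between_iff_balls\<close>): although the radii are integers, they
  may be arbitrarily large and the centres are arbitrary, so every face of the box can be cut out.
  Hence a step-isometry preserves the relation ``\<open>z\<close> lies in the box spanned by \<open>x\<close> and \<open>y\<close>''. This
  relation no longer refers to any metric, and it is rigid enough to recover the coordinates.

  A box degenerates to an axis-parallel segment iff its points are linearly ordered by
  betweenness (\<open>axis_parallel_iff_chain\<close>), so \<open>f\<close> maps axis-parallel segments to axis-parallel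
  segments. Moving one side of an axis-parallel rectangle onto the opposite one shows that
  parallel segments have images in the same direction (\<open>direction_parallel\<close>). So the direction of
  the image depends only on the coordinate \<open>i\<close> that changes; call it \<open>\<sigma> i\<close>. Then \<open>\<sigma>\<close> is a
  permutation and \<open>f x $ \<sigma> i\<close> is a function \<open>h i\<close> of \<open>x $ i\<close> alone (\<open>coordinatewise\<close>).

  Each \<open>h i\<close> is a surjective function of one real variable which preserves betweenness, hence is
  monotone (\<open>betweenness_sign\<close>), and which again preserves floors of distances. After subtracting
  \<open>h i 0\<close> and correcting the sign it is increasing and commutes with the shift by 1
  (\<open>step_preserving_increasing\<close>): the point with image \<open>h t + 1\<close> must have distance at least 1
  from \<open>t\<close>, but it cannot lie beyond \<open>t + 1\<close>. The function \<open>g i\<close> is this normalised \<open>h i\<close>.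
\<close>

section \<open>Coordinatewise betweenness from balls of integer radius\<close>

definition box_between :: "real ^ 'n \<Rightarrow> real ^ 'n \<Rightarrow> real ^ 'n \<Rightarrow> bool" where
  "box_between z x y \<longleftrightarrow> (\<forall>i. min (x $ i) (y $ i) \<le> z $ i \<and> z $ i \<le> max (x $ i) (y $ i))"

lemma infnorm_less_iff:
  fixes x :: "real ^ 'n"
  shows "infnorm x < r \<longleftrightarrow> (\<forall>i. \<bar>x $ i\<bar> < r)"
  by (simp add: infnorm_vec_eq_Max)

text \<open>
  A point outside the box is beyond one of its faces, say in direction \<open>s = \<plusminus>1\<close> along coordinate
  \<open>i\<close>. A cube whose boundary face lies at a height \<open>m\<close> strictly between that face and \<open>z $ i\<close>, and
  which extends far enough away from \<open>z\<close>, contains \<open>x\<close> and \<open>y\<close>. Its radius only has to be large,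
  so it can be an integer.
\<close>

lemma separating_ball:
  fixes x y z :: "real ^ 'n"
  assumes "\<not> box_between z x y"
  shows "\<exists>c (n::nat). infnorm (x - c) < n \<and> infnorm (y - c) < n \<and> \<not> infnorm (z - c) < n"
proof -
  obtain i where i: "z $ i < min (x $ i) (y $ i) \<or> max (x $ i) (y $ i) < z $ i"
    using assms by (auto simp: box_between_def not_le)
  define b where "b = (if z $ i < min (x $ i) (y $ i) then min (x $ i) (y $ i) else max (x $ i) (y $ i))"
  define m where "m = (z $ i + b) / 2"
  define s :: real where "s = (if z $ i < min (x $ i) (y $ i) then -1 else 1)"
  obtain n :: nat where n: "infnorm (x - y) + \<bar>x $ i - m\<bar> + \<bar>y $ i - m\<bar> < n"
    using reals_Archimedean2 by blast
  have xy: "\<bar>x $ j - y $ j\<bar> < n" for j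
    using n infnorm_less_iff[of "x - y" "real n"] by force
  have nx: "\<bar>x $ i - m\<bar> < n" "\<bar>y $ i - m\<bar> < n" and "0 < n"
    using n infnorm_pos_le[of "x - y"] by linarith+
  define c where "c = (\<chi> j. if j = i then m - s * n else x $ j)"
  have side: "s * (z $ i - m) > 0" "s * (x $ i - m) < 0" "s * (y $ i - m) < 0"
    using i by (auto simp: m_def s_def b_def min_def max_def split: if_splits)
  have s: "s = 1 \<or> s = -1" by (auto simp: s_def)
  have "\<bar>x $ i - c $ i\<bar> < n" "\<bar>y $ i - c $ i\<bar> < n" "\<not> \<bar>z $ i - c $ i\<bar> < n"
    using side s nx by (auto simp: c_def abs_less_iff)
  moreover have "\<bar>x $ j - c $ j\<bar> < n" "\<bar>y $ j - c $ j\<bar> < n" if "j \<noteq> i" for j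
    using that xy[of j] \<open>0 < n\<close> by (auto simp: c_def abs_minus_commute)
  ultimately show ?thesis
    unfolding infnorm_less_iff vector_minus_component by metis
qed

lemma box_between_iff_balls:
  fixes x y z :: "real ^ 'n"
  shows "box_between z x y \<longleftrightarrow>
    (\<forall>c (n::nat). infnorm (x - c) < n \<longrightarrow> infnorm (y - c) < n \<longrightarrow> infnorm (z - c) < n)"
    (is "_ \<longleftrightarrow> ?R")
proof
  assume B: "box_between z x y"
  show ?R
  proof (intro allI impI)
    fix c and n :: nat
    assume less: "infnorm (x - c) < n" "infnorm (y - c) < n"
    show "infnorm (z - c) < n"
      unfolding infnorm_less_iff
    proof
      fix i
      have "\<bar>x $ i - c $ i\<bar> < n" "\<bar>y $ i - c $ i\<bar> < n"
        using less by (auto simp: infnorm_less_iff)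
      moreover have "min (x $ i) (y $ i) \<le> z $ i" "z $ i \<le> max (x $ i) (y $ i)"
        using B by (auto simp: box_between_def)
      ultimately show "\<bar>(z - c) $ i\<bar> < n"
        by (auto simp: min_def max_def abs_less_iff split: if_splits)
    qed
  qed
next
  show "?R \<Longrightarrow> box_between z x y" using separating_ball by blast
qed

lemma step_isometry_box_between:
  fixes f :: "real ^ 'n \<Rightarrow> real ^ 'n"
  assumes "step_isometry infnorm f"
  shows "box_between (f z) (f x) (f y) \<longleftrightarrow> box_between z x y"
proof -
  have less: "infnorm (f u - f c) < real n \<longleftrightarrow> infnorm (u - c) < real n" for u c and n :: nat
    using assms unfolding step_isometry_def
    by (metis floor_less_iff of_int_of_nat_eq)
  have surj: "surj f"
    using assms by (simp add: step_isometry_def bij_is_surj)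
  have all: "(\<forall>c. P c) \<longleftrightarrow> (\<forall>c. P (f c))" for P
    using surj by (metis surjD)
  show ?thesis
    unfolding box_between_iff_balls by (subst all) (simp only: less)
qed

section \<open>Maps preserving coordinatewise betweenness\<close>

definition differing :: "real ^ 'n \<Rightarrow> real ^ 'n \<Rightarrow> 'n set" where
  "differing x y = {i. x $ i \<noteq> y $ i}"

lemma differing_eq_singleton_iff: "differing x y = {k} \<longleftrightarrow> (\<forall>j. x $ j = y $ j \<longleftrightarrow> j \<noteq> k)"
  by (auto simp: differing_def)

lemma differing_subset_singleton_iff:
  "differing x y \<subseteq> {k} \<longleftrightarrow> (\<forall>j. j \<noteq> k \<longrightarrow> x $ j = y $ j)"
  by (auto simp: differing_def)

definition vec_update :: "real ^ 'n \<Rightarrow> 'n \<Rightarrow> real \<Rightarrow> real ^ 'n" where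
  "vec_update x i t = (\<chi> j. if j = i then t else x $ j)"

lemma vec_update_component [simp]: "vec_update x i t $ j = (if j = i then t else x $ j)"
  by (simp add: vec_update_def)

text \<open>
  This expresses ``\<open>x\<close> and \<open>y\<close> differ in at most one coordinate'' through betweenness alone. If
  they differ in two coordinates, two corners of the box adjacent to \<open>x\<close> are incomparable.
\<close>

lemma axis_parallel_iff_chain:
  fixes x y :: "real ^ 'n"
  shows "(\<exists>i. differing x y \<subseteq> {i}) \<longleftrightarrow>
    (\<forall>u v. box_between u x y \<longrightarrow> box_between v x y \<longrightarrow> box_between v x u \<or> box_between u x v)"
    (is "?L \<longleftrightarrow> ?R")
proof
  assume ?L
  then obtain i where i: "x $ j = y $ j" if "j \<noteq> i" for j
    by (auto simp: differing_def)
  show ?R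
  proof (intro allI impI)
    fix u v
    assume uv: "box_between u x y" "box_between v x y"
    have eq: "u $ j = x $ j" "v $ j = x $ j" if "j \<noteq> i" for j
      using uv i[OF that] by (auto simp: box_between_def antisym dest!: spec[of _ j])
    have "(min (x $ i) (u $ i) \<le> v $ i \<and> v $ i \<le> max (x $ i) (u $ i)) \<or>
      (min (x $ i) (v $ i) \<le> u $ i \<and> u $ i \<le> max (x $ i) (v $ i))"
      using uv[unfolded box_between_def, THEN spec[of _ i]] by linarith
    then show "box_between v x u \<or> box_between u x v"
      unfolding box_between_def using eq
      by (metis max.idem min.idem order_refl)
  qed
next
  assume R: ?R
  show ?L
  proof (rule ccontr)
    assume "\<not> ?L"
    then obtain i j where ij: "i \<noteq> j" "x $ i \<noteq> y $ i" "x $ j \<noteq> y $ j"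
      unfolding differing_def by blast
    have "box_between (vec_update x i (y $ i)) x y" "box_between (vec_update x j (y $ j)) x y"
      by (auto simp: box_between_def)
    moreover have "\<not> box_between (vec_update x j (y $ j)) x (vec_update x i (y $ i))"
      unfolding box_between_def not_all by (rule exI[of _ j]) (use ij in auto)
    moreover have "\<not> box_between (vec_update x i (y $ i)) x (vec_update x j (y $ j))"
      unfolding box_between_def not_all by (rule exI[of _ i]) (use ij in auto)
    ultimately show False using R by blast
  qed
qed

text \<open>
  The components of \<open>x\<close> in \<open>J\<close> are replaced by those of \<open>y\<close> one at a time; this propagates
  statements about single axis-parallel moves to arbitrary pairs of points.
\<close>

lemma vec_update_induct:
  fixes x y :: "real ^ 'n"
  assumes "P x" and step: "\<And>x j. j \<in> J \<Longrightarrow> P x \<Longrightarrow> P (vec_update x j (y $ j))"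
    and "differing x y \<subseteq> J"
  shows "P y"
proof -
  have "P (\<chi> j. if j \<in> A then y $ j else x $ j)" if "finite A" "A \<subseteq> J" for A
    using that
  proof (induction A)
    case empty
    show ?case using \<open>P x\<close> by simp
  next
    case (insert a A)
    have "(\<chi> j. if j \<in> insert a A then y $ j else x $ j) =
        vec_update (\<chi> j. if j \<in> A then y $ j else x $ j) a (y $ a)"
      by (auto simp: vec_eq_iff)
    with insert step show ?case by simp
  qed
  from this[of J] have "P (\<chi> j. if j \<in> J then y $ j else x $ j)" by simp
  moreover have "(\<chi> j. if j \<in> J then y $ j else x $ j) = y"
    using assms(3) by (auto simp: vec_eq_iff differing_def)
  ultimately show ?thesis by simp
qed

locale box_between_automorphism =
  fixes f :: "real ^ 'n \<Rightarrow> real ^ 'n"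
  assumes between: "box_between (f z) (f x) (f y) \<longleftrightarrow> box_between z x y"
    and surj: "surj f"
begin

lemma eq_iff: "f x = f y \<longleftrightarrow> x = y"
proof -
  have "box_between z x x \<longleftrightarrow> z = x" for x z :: "real ^ 'n"
    by (auto simp: box_between_def vec_eq_iff antisym)
  then show ?thesis using between by metis
qed

lemma axis_parallel_iff:
  "(\<exists>i. differing (f x) (f y) \<subseteq> {i}) \<longleftrightarrow> (\<exists>i. differing x y \<subseteq> {i})"
proof -
  have all: "(\<forall>c. P c) \<longleftrightarrow> (\<forall>c. P (f c))" for P
    using surj by (metis surjD)
  show ?thesis
    unfolding axis_parallel_iff_chain
    by (subst all, subst (2) all) (simp only: between)
qed

lemma differing_singleton:
  assumes "differing x y = {i}"
  shows "\<exists>k. differing (f x) (f y) = {k}"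
proof -
  have "x \<noteq> y" using assms by (auto simp: differing_def)
  then have "differing (f x) (f y) \<noteq> {}"
    using eq_iff[of x y] by (auto simp: differing_def vec_eq_iff)
  moreover have "\<exists>i. differing (f x) (f y) \<subseteq> {i}"
    using axis_parallel_iff assms by blast
  ultimately show ?thesis by blast
qed

text \<open>
  Three points on an axis-parallel line have images that pairwise differ in at most one coordinate.
  This coordinate is the same for all three pairs: two moves along distinct axes would give points
  that differ in two coordinates.
\<close>

lemma direction_collinear:
  assumes "differing x y = {i}" "differing x z \<subseteq> {i}" "differing (f x) (f y) = {k}"
  shows "differing (f x) (f z) \<subseteq> {k}"
proof -
  have "differing y z \<subseteq> {i}"
    using assms(1,2) unfolding differing_eq_singleton_iff differing_subset_singleton_iff by metis
  then obtain l m where "differing (f y) (f z) \<subseteq> {l}" "differing (f x) (f z) \<subseteq> {m}"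
    using axis_parallel_iff assms(2) by meson
  then show ?thesis
    using assms(3) unfolding differing_eq_singleton_iff differing_subset_singleton_iff by metis
qed

text \<open>
  The points form the rectangle \<open>x, y, y', x'\<close>. Its diagonals are not axis-parallel, so neither are
  their images. Hence the images of the sides \<open>x x'\<close> and \<open>y y'\<close> leave the coordinate \<open>k\<close>
  unchanged, and the difference of \<open>f x\<close> and \<open>f y\<close> in that coordinate is carried over to the
  opposite side.
\<close>

lemma direction_parallel:
  assumes xy: "differing x y = {i}" and xx': "differing x x' = {j}"
    and yy': "differing y y' = {j}" and xy': "differing x' y' = {i}" and "i \<noteq> j"
    and k: "differing (f x) (f y) = {k}"
  shows "differing (f x') (f y') = {k}"
proof -
  obtain l m k' where l: "differing (f x) (f x') = {l}"
    and m: "differing (f y) (f y') = {m}" and k': "differing (f x') (f y') = {k'}"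
    using differing_singleton xx' yy' xy' by meson
  note eqs = xy xx' yy' xy' k l m k'
  note coords = eqs[unfolded differing_eq_singleton_iff, rule_format]
  have "y $ i \<noteq> x' $ i" "y $ j \<noteq> x' $ j" "x $ i \<noteq> y' $ i" "x $ j \<noteq> y' $ j"
    using coords(1-4)[of i] coords(1-4)[of j] \<open>i \<noteq> j\<close> by simp_all
  then have "\<not> differing y x' \<subseteq> {n}" "\<not> differing x y' \<subseteq> {n}" for n
    using \<open>i \<noteq> j\<close> unfolding differing_def by blast+
  then have diag: "\<not> differing (f y) (f x') \<subseteq> {n}" "\<not> differing (f x) (f y') \<subseteq> {n}" for n
    using axis_parallel_iff by blast+
  have "k \<noteq> l"
  proof
    assume "k = l"
    then have "f y $ n = f x' $ n" if "n \<noteq> k" for n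
      using coords(5,6)[of n] that by simp
    then show False using diag(1)[of k] by (auto simp: differing_def)
  qed
  have "k \<noteq> m"
  proof
    assume "k = m"
    then have "f x $ n = f y' $ n" if "n \<noteq> k" for n
      using coords(5,7)[of n] that by simp
    then show False using diag(2)[of k] by (auto simp: differing_def)
  qed
  have "f x $ k \<noteq> f y $ k" "f x' $ k = f x $ k" "f y' $ k = f y $ k"
    using coords(5-7)[of k] \<open>k \<noteq> l\<close> \<open>k \<noteq> m\<close> by simp_all
  then have "k \<in> differing (f x') (f y')" by (simp add: differing_def)
  then show ?thesis using k' by simp
qed

text \<open>
  The direction is read off at the origin and carried to every other point by changing one
  coordinate at a time: a change of the coordinate \<open>i\<close> itself stays on the same line, and any other
  change is a parallel displacement.
\<close>

lemma coordinate_direction: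
  "\<exists>k. \<forall>x t. differing (f x) (f (vec_update x i t)) \<subseteq> {k}"
proof -
  have unit: "differing 0 (vec_update 0 i 1) = {i}"
    by (auto simp: differing_def)
  then obtain k where k: "differing (f 0) (f (vec_update 0 i 1)) = {k}"
    using differing_singleton by blast
  define P where "P x \<longleftrightarrow> (\<forall>t. differing (f x) (f (vec_update x i t)) \<subseteq> {k})" for x
  have "P 0"
    unfolding P_def by (intro allI direction_collinear[OF unit _ k]) (auto simp: differing_def)
  have step: "P (vec_update x j s)" if "P x" for x j s
  proof (cases "j = i")
    case True
    have "vec_update (vec_update x i s) i t = vec_update x i t" for t
      by (simp add: vec_eq_iff)
    then show ?thesis
      using \<open>P x\<close> unfolding P_def True differing_subset_singleton_iff by simp
  next
    case False
    show ?thesis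
      unfolding P_def
    proof
      fix t
      let ?x' = "vec_update x j s"
      show "differing (f ?x') (f (vec_update ?x' i t)) \<subseteq> {k}"
      proof (cases "t = x $ i \<or> s = x $ j")
        case True
        then have "vec_update ?x' i t = ?x' \<or> ?x' = x"
          using False by (auto simp: vec_eq_iff)
        then show ?thesis using \<open>P x\<close> by (auto simp: P_def differing_subset_singleton_iff)
      next
        case neq: False
        have d: "differing x (vec_update x i t) = {i}"
          using neq by (auto simp: differing_def)
        then have dk: "differing (f x) (f (vec_update x i t)) = {k}"
          using \<open>P x\<close> differing_singleton[OF d] by (force simp: P_def)
        have "differing (f ?x') (f (vec_update ?x' i t)) = {k}"
        proof (rule direction_parallel[OF d _ _ _ _ dk])
          show "differing x ?x' = {j}"
            "differing (vec_update x i t) (vec_update ?x' i t) = {j}"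
            "differing ?x' (vec_update ?x' i t) = {i}"
            using neq False by (simp_all add: differing_eq_singleton_iff)
        qed (use False in simp)
        then show ?thesis by simp
      qed
    qed
  qed
  have "P x" for x
    using vec_update_induct[of P 0 UNIV x] \<open>P 0\<close> step by blast
  then show ?thesis unfolding P_def by blast
qed

text \<open>
  If two axes were sent to the same direction, the images of two unit vectors would differ in only
  one coordinate, whereas the unit vectors differ in two. So \<open>\<sigma>\<close> is injective, and changing the
  coordinates other than \<open>i\<close> never affects the coordinate \<open>\<sigma> i\<close> of the image.
\<close>

lemma coordinatewise:
  obtains \<sigma> where "\<sigma> permutes UNIV" and "\<And>x y i. x $ i = y $ i \<Longrightarrow> f x $ \<sigma> i = f y $ \<sigma> i"
proof -
  obtain \<sigma> where \<sigma>: "\<And>i x t. differing (f x) (f (vec_update x i t)) \<subseteq> {\<sigma> i}"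
    using coordinate_direction by metis
  have "inj \<sigma>"
  proof (rule injI, rule ccontr)
    fix i j
    assume ij: "\<sigma> i = \<sigma> j" "i \<noteq> j"
    have "differing (f (vec_update 0 i 1)) (f (vec_update 0 j 1)) \<subseteq> {\<sigma> i}"
      using \<sigma>[of 0 i 1] \<sigma>[of 0 j 1] ij(1) by (force simp: differing_def)
    then obtain k where "differing (vec_update 0 i 1) (vec_update 0 j 1) \<subseteq> {k}"
      using axis_parallel_iff by blast
    then have "i = k" "j = k"
      using \<open>i \<noteq> j\<close> unfolding differing_subset_singleton_iff by (auto split: if_splits)
    then show False using \<open>i \<noteq> j\<close> by simp
  qed
  then have "\<sigma> permutes UNIV"
    by (simp add: permutes_def) (metis finite_UNIV_inj_surj finite injD surjD)
  moreover have "f x $ \<sigma> i = f y $ \<sigma> i" if "x $ i = y $ i" for x y i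
  proof (rule vec_update_induct[of "\<lambda>z. f x $ \<sigma> i = f z $ \<sigma> i" x "- {i}" y])
    show "differing x y \<subseteq> - {i}" using that by (auto simp: differing_def)
  next
    fix z j
    assume "j \<in> - {i}" and eq: "f x $ \<sigma> i = f z $ \<sigma> i"
    then have "\<sigma> i \<notin> differing (f z) (f (vec_update z j (y $ j)))"
      using \<sigma>[of z j "y $ j"] \<open>inj \<sigma>\<close> by (auto dest: injD)
    then show "f x $ \<sigma> i = f (vec_update z j (y $ j)) $ \<sigma> i"
      using eq by (simp add: differing_def)
  qed simp
  ultimately show thesis by (rule that)
qed

end

section \<open>Step-isometries of the real line\<close>

text \<open>
  For \<open>a < b < c\<close> the three pairs are either all increased or all decreased by \<open>h\<close>. The pairs
  \<open>(s, t)\<close> and \<open>(0, 1)\<close> are compared through a common interval \<open>(m, M)\<close> that strictly contains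
  both.
\<close>

lemma betweenness_sign:
  fixes h :: "real \<Rightarrow> real"
  assumes inj: "inj h"
    and btw: "\<And>a b c. a \<le> b \<Longrightarrow> b \<le> c \<Longrightarrow> min (h a) (h c) \<le> h b \<and> h b \<le> max (h a) (h c)"
    and "s < t"
  shows "h s < h t \<longleftrightarrow> h 0 < h 1"
proof -
  have 3: "(h a < h b \<longleftrightarrow> h a < h c) \<and> (h b < h c \<longleftrightarrow> h a < h c)" if "a < b" "b < c" for a b c
    using btw[of a b c] that inj_eq[OF inj, of a b] inj_eq[OF inj, of b c]
    by (auto simp: min_def max_def split: if_splits)
  define m M where "m = min s 0 - 1" and "M = max t 1 + 1"
  have "m < s" "m < 0" "t < M" "1 < M" by (auto simp: m_def M_def)
  then show ?thesis
    using 3[of m s t] 3[of m t M] 3[of m 0 1] 3[of m 1 M] \<open>s < t\<close> by auto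
qed

text \<open>
  Everything follows from \<open>H (t + 1) = H t + 1\<close>. Preservation of floors gives only \<open>\<ge>\<close>, since the
  distance of \<open>H (t + 1)\<close> and \<open>H t\<close> lies in \<open>[1, 2)\<close>. Surjectivity gives a point \<open>u\<close> with image
  \<open>H t + 1\<close>. It lies in the interval \<open>(t, t + 1]\<close> by monotonicity, and has distance at least 1
  from \<open>t\<close> by preservation of floors, so \<open>u = t + 1\<close>.
\<close>

lemma step_preserving_increasing:
  fixes H :: "real \<Rightarrow> real"
  assumes mono: "strict_mono H" and surj: "surj H" and "H 0 = 0"
    and step: "\<And>s t. \<lfloor>\<bar>s - t\<bar>\<rfloor> = \<lfloor>\<bar>H s - H t\<bar>\<rfloor>"
  shows "bij_betw H {0..<1} {0..<1}" and "H t = H (t - of_int \<lfloor>t\<rfloor>) + of_int \<lfloor>t\<rfloor>"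
proof -
  have plus1: "H (t + 1) = H t + 1" for t
  proof -
    have "H t < H (t + 1)" using mono by (simp add: strict_mono_def)
    then have ge: "H t + 1 \<le> H (t + 1)"
      using step[of "t + 1" t] by simp linarith
    obtain u where u: "H u = H t + 1" using surj by (metis surjD)
    then have "H t < H u" "H u \<le> H (t + 1)" using ge by simp_all
    then have "t < u" "u \<le> t + 1"
      using mono by (simp_all add: strict_mono_less strict_mono_less_eq)
    moreover have "\<lfloor>\<bar>u - t\<bar>\<rfloor> = 1" using step[of u t] u by simp
    ultimately have "u = t + 1" by linarith
    then show ?thesis using u by simp
  qed
  have shift: "H (t + of_int n) = H t + of_int n" for n t
  proof (induction n arbitrary: t rule: int_induct[where k = 0])
    case (step1 n)
    show ?case using step1(2)[of t] plus1[of "t + of_int n"] by (simp add: algebra_simps)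
  next
    case (step2 n)
    show ?case using step2(2)[of t] plus1[of "t + of_int (n - 1)"] by (simp add: algebra_simps)
  qed simp
  show "H t = H (t - of_int \<lfloor>t\<rfloor>) + of_int \<lfloor>t\<rfloor>"
    using shift[of "t - of_int \<lfloor>t\<rfloor>" "\<lfloor>t\<rfloor>"] by simp
  have "H 1 = 1" using plus1[of 0] \<open>H 0 = 0\<close> by simp
  then have "H u \<in> {0..<1} \<longleftrightarrow> u \<in> {0..<1}" for u
    using strict_mono_less_eq[OF mono, of 0 u] strict_mono_less[OF mono, of u 1] \<open>H 0 = 0\<close> by simp
  then have "H -` {0..<1} = {0..<1}" by blast
  then have "H ` {0..<1} = {0..<1}"
    using surj_image_vimage_eq[OF surj, of "{0..<1}"] by simp
  then show "bij_betw H {0..<1} {0..<1}"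
    using mono by (simp add: bij_betw_def strict_mono_imp_inj_on inj_on_subset)
qed

section \<open>Step-isometries of the maximum norm\<close>

theorem theorem5:
  fixes f :: "real ^ 'n \<Rightarrow> real ^ 'n"
  assumes "step_isometry infnorm f"
  shows "\<exists>(\<sigma> :: 'n \<Rightarrow> 'n) (\<epsilon> :: real ^ 'n) (g :: 'n \<Rightarrow> real \<Rightarrow> real).
    \<sigma> permutes UNIV \<and>
    (\<forall>i. \<epsilon> $ i \<in> {-1, 1}) \<and>
    (\<forall>i. bij_betw (g i) {0..<1} {0..<1} \<and> strict_mono_on {0..<1} (g i)) \<and>
    (\<forall>l :: 'n \<Rightarrow> real.
      f (\<Sum>i\<in>UNIV. l i *\<^sub>R axis i 1) - f 0 =
        (\<Sum>i\<in>UNIV. ((g i (l i - of_int \<lfloor>l i\<rfloor>) + of_int \<lfloor>l i\<rfloor>) * \<epsilon> $ i) *\<^sub>R axis (\<sigma> i) 1))"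
proof -
  have surj: "surj f" using assms by (simp add: step_isometry_def bij_is_surj)
  interpret box_between_automorphism f
    using step_isometry_box_between[OF assms] surj by unfold_locales
  obtain \<sigma> where \<sigma>: "\<sigma> permutes UNIV"
    and coord: "\<And>x y i. x $ i = y $ i \<Longrightarrow> f x $ \<sigma> i = f y $ \<sigma> i"
    using coordinatewise by blast
  have \<sigma>_bij: "bij \<sigma>" using \<sigma> by (simp add: permutes_bij)
  define h where "h i t = f (axis i t) $ \<sigma> i" for i t
  have f_coord: "f x $ \<sigma> i = h i (x $ i)" for x i
    unfolding h_def by (rule coord) (simp add: axis_def)
  have f_axis: "f (axis i s) $ \<sigma> j = f (axis i t) $ \<sigma> j" if "j \<noteq> i" for i j s t
    by (rule coord) (use that in \<open>simp add: axis_def\<close>)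
  have all_\<sigma>: "(\<forall>k. P k) \<longleftrightarrow> (\<forall>j. P (\<sigma> j))" for P
    using bij_is_surj[OF \<sigma>_bij] by (metis surjD)
  \<comment> \<open>Moving along axis \<open>i\<close> changes the image only in the coordinate \<open>\<sigma> i\<close>, so there the maximum
    norm is the absolute value and the hypothesis on \<open>f\<close> passes to \<open>h i\<close>.\<close>
  have h_step: "\<lfloor>\<bar>s - t\<bar>\<rfloor> = \<lfloor>\<bar>h i s - h i t\<bar>\<rfloor>" for i s t
  proof -
    have "axis i s - axis i t = (axis i (s - t) :: real ^ 'n)"
      by (auto simp: vec_eq_iff axis_def)
    moreover have "f (axis i s) - f (axis i t) = axis (\<sigma> i) (h i s - h i t)"
      unfolding vec_eq_iff
    proof (subst all_\<sigma>, intro allI)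
      fix j
      show "(f (axis i s) - f (axis i t)) $ \<sigma> j = axis (\<sigma> i) (h i s - h i t) $ \<sigma> j"
        using f_axis[of j i s t] bij_is_inj[OF \<sigma>_bij]
        by (cases "j = i") (auto simp: h_def axis_def inj_eq)
    qed
    moreover have "infnorm (axis k r :: real ^ 'n) = \<bar>r\<bar>" for k r
    proof -
      have "infnorm (axis k r :: real ^ 'n) < u \<longleftrightarrow> \<bar>r\<bar> < u" for u
        unfolding infnorm_less_iff by (auto simp: axis_def)
      then show ?thesis by (metis less_irrefl not_less_iff_gr_or_eq)
    qed
    ultimately show ?thesis
      using assms unfolding step_isometry_def by metis
  qed
  have h_surj: "surj (h i)" for i
  proof -
    have "\<exists>t. h i t = u" for u
    proof -
      obtain x where "f x = axis (\<sigma> i) u" using surj by (metis surjD)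
      then show ?thesis using f_coord[of x i] by (metis axis_nth)
    qed
    then show ?thesis by (metis surj_def)
  qed
  have h_between: "min (h i a) (h i c) \<le> h i b \<and> h i b \<le> max (h i a) (h i c)"
    if "a \<le> b" "b \<le> c" for i a b c
  proof -
    have "box_between (axis i b) (axis i a) (axis i c)"
      using that by (auto simp: box_between_def axis_def)
    then show ?thesis
      using between unfolding box_between_def h_def by blast
  qed
  have h_inj: "inj (h i)" for i
  proof (rule injI)
    fix s t assume "h i s = h i t"
    then have "f (axis i s) $ \<sigma> j = f (axis i t) $ \<sigma> j" for j
      using f_axis[of j i s t] by (cases "j = i") (auto simp: h_def)
    then have "f (axis i s) = f (axis i t)"
      unfolding vec_eq_iff using all_\<sigma>[of "\<lambda>k. f (axis i s) $ k = f (axis i t) $ k"] by blast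
    then show "s = t" by (metis eq_iff axis_nth)
  qed
  define \<epsilon> :: "real ^ 'n" where "\<epsilon> = (\<chi> i. if h i 0 < h i 1 then 1 else -1)"
  define g where "g i t = \<epsilon> $ i * (h i t - h i 0)" for i t
  have \<epsilon>: "\<epsilon> $ i = 1 \<or> \<epsilon> $ i = -1" for i by (simp add: \<epsilon>_def)
  have g_mono: "strict_mono (g i)" for i
  proof (rule strict_monoI)
    fix s t :: real assume "s < t"
    have "h i s < h i t \<longleftrightarrow> h i 0 < h i 1"
      by (rule betweenness_sign[of "h i", OF h_inj _ \<open>s < t\<close>]) (rule h_between)
    moreover have "h i s \<noteq> h i t"
      using \<open>s < t\<close> inj_eq[OF h_inj, of i s t] by simp
    ultimately show "g i s < g i t" by (auto simp: g_def \<epsilon>_def)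
  qed
  have g_surj: "surj (g i)" for i
  proof -
    have "\<exists>t. g i t = u" for u
    proof -
      obtain t where "h i t = \<epsilon> $ i * u + h i 0" using h_surj by (metis surjD)
      then show ?thesis using \<epsilon>[of i] by (auto simp: g_def intro!: exI[of _ t])
    qed
    then show ?thesis by (metis surj_def)
  qed
  have g_step: "\<lfloor>\<bar>s - t\<bar>\<rfloor> = \<lfloor>\<bar>g i s - g i t\<bar>\<rfloor>" for i s t
  proof -
    have "\<bar>g i s - g i t\<bar> = \<bar>h i s - h i t\<bar>"
      using \<epsilon>[of i] by (auto simp: g_def)
    then show ?thesis using h_step by simp
  qed
  have "g i 0 = 0" for i by (simp add: g_def)
  then have g_bij: "bij_betw (g i) {0..<1} {0..<1}"
    and g_floor: "g i t = g i (t - of_int \<lfloor>t\<rfloor>) + of_int \<lfloor>t\<rfloor>" for i t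
    using step_preserving_increasing[of "g i", OF g_mono g_surj _ g_step] by blast+
  have "f (\<Sum>i\<in>UNIV. l i *\<^sub>R axis i 1) - f 0 =
        (\<Sum>i\<in>UNIV. ((g i (l i - of_int \<lfloor>l i\<rfloor>) + of_int \<lfloor>l i\<rfloor>) * \<epsilon> $ i) *\<^sub>R axis (\<sigma> i) 1)" for l
    unfolding vec_eq_iff
  proof (subst all_\<sigma>, intro allI)
    fix j
    have "(f (\<Sum>i\<in>UNIV. l i *\<^sub>R axis i 1) - f 0) $ \<sigma> j = h j (l j) - h j 0"
      by (simp add: f_coord axis_def if_distrib cong: if_cong)
    also have "\<dots> = g j (l j) * \<epsilon> $ j"
      using \<epsilon>[of j] by (auto simp: g_def)
    also have "\<dots> = (\<Sum>i\<in>UNIV. (g i (l i) * \<epsilon> $ i) *\<^sub>R axis (\<sigma> i) 1) $ \<sigma> j"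
      by (simp add: axis_def inj_eq[OF bij_is_inj[OF \<sigma>_bij]] if_distrib cong: if_cong)
    finally show "(f (\<Sum>i\<in>UNIV. l i *\<^sub>R axis i 1) - f 0) $ \<sigma> j =
        (\<Sum>i\<in>UNIV. ((g i (l i - of_int \<lfloor>l i\<rfloor>) + of_int \<lfloor>l i\<rfloor>) * \<epsilon> $ i) *\<^sub>R axis (\<sigma> i) 1) $ \<sigma> j"
      by (simp only: g_floor[symmetric])
  qed
  moreover have "strict_mono_on {0..<1} (g i)" for i
    using g_mono by (simp add: strict_mono_on_def strict_mono_def)
  ultimately show ?thesis
    using \<sigma> \<epsilon> g_bij by (intro exI[of _ \<sigma>] exI[of _ \<epsilon>] exI[of _ g]) auto
qed

end
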